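(* For every tone $k$, user $n$ and approximation point $\tilde{\mathbf s}_k\in\mathcal S_k$, the approximation $f_k^{\mathrm{IASB1}}$ is tighter than the approximation $f_k^{\mathrm{CADSB}}$ (as functions of $s_k^n\in\mathcal S_k^n$).
   Context: Users $\mathcal N=\{1,\dots,N\}$. On tone $k$, $\mathbf s_k=(s_k^1,\dots,s_k^N)$ are the transmit powers, $\mathcal S_k^n=[0,s_k^{n,\mathrm{mask}}]$ with $s_k^{n,\mathrm{mask}}>0$, $\mathcal S_k=\prod_n\mathcal S_k^n$. Constants: weights $w_n\ge0$, gains $a_k^{n,m}\ge0$, noise powers $z_k^n>0$. Put $\mathrm{int}_k^n=\sum_{m\ne n}a_k^{n,m}s_k^m+z_k^n$, $\mathrm{rec}_k^n=s_k^n+\mathrm{int}_k^n$, and $f_k(\mathbf s_k)=-\sum_{m\in\mathcal N}w_m\log(1+s_k^m/\mathrm{int}_k^m)$. Fix user $n$; all functions below are functions of the single variable $s_k^n\in\mathcal S_k^n$, with $s_k^m=\tilde s_k^m$ for all $m\ne n$. Given a decomposition $f_k=f_k^1+f_k^2$, the associated approximation is $f_k^1+\mathrm{LIN}(f_k^2)$, where $\mathrm{LIN}(f_k^2)$ is the first-order (affine) Taylor approximation of $f_k^2$ at $s_k^n=\tilde s_k^n$. - $f_k^{\mathrm{CADSB}}$ is the approximation with $f_k^2=\sum_{m\in\mathcal N}w_m\log(\mathrm{int}_k^m)$ (and $f_k^1=-\sum_{m\in\mathcal N}w_m\log(\mathrm{rec}_k^m)$). - $f_k^{\mathrm{IASB1}}$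 is the approximation with $f_k^1=-w_n\log(1+s_k^n/\mathrm{int}_k^n)$ and $f_k^2=-\sum_{m\ne n}w_m\log(1+s_k^m/\mathrm{int}_k^m)$. An approximation $A$ is "tighter" than $B$ if its approximation error is no larger along the dimension $s_k^n$: $f_k(s_k^n)\le A(s_k^n)\le B(s_k^n)$ for all $s_k^n\in\mathcal S_k^n$. *)

theory Defs
  imports "HOL-Analysis.Analysis"
begin

text \<open>
  Users are \<open>{1..N}\<close>; tones have an arbitrary index type \<open>'k\<close>. The system data are the weights
  \<open>w n\<close>, the gains \<open>a k n m\<close> (from transmitter \<open>m\<close> to receiver \<open>n\<close>), the noise powers
  \<open>z k n\<close> and the spectral masks \<open>smask k n\<close>. A power vector on one tone is a function
  \<open>s :: nat \<Rightarrow> real\<close>, of which only the entries in \<open>{1..N}\<close> matter.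
\<close>

definition power_interval :: "('k \<Rightarrow> nat \<Rightarrow> real) \<Rightarrow> 'k \<Rightarrow> nat \<Rightarrow> real set" where
  "power_interval smask k n = {0..smask k n}"

definition power_box :: "nat \<Rightarrow> ('k \<Rightarrow> nat \<Rightarrow> real) \<Rightarrow> 'k \<Rightarrow> (nat \<Rightarrow> real) set" where
  "power_box N smask k = (\<Pi>\<^sub>E n\<in>{1..N}. power_interval smask k n)"

definition interf ::
  "nat \<Rightarrow> ('k \<Rightarrow> nat \<Rightarrow> nat \<Rightarrow> real) \<Rightarrow> ('k \<Rightarrow> nat \<Rightarrow> real) \<Rightarrow> 'k \<Rightarrow> (nat \<Rightarrow> real) \<Rightarrow> nat \<Rightarrow> real"
where
  "interf N a z k s n = (\<Sum>m\<in>{1..N} - {n}. a k n m * s m) + z k n"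

definition received ::
  "nat \<Rightarrow> ('k \<Rightarrow> nat \<Rightarrow> nat \<Rightarrow> real) \<Rightarrow> ('k \<Rightarrow> nat \<Rightarrow> real) \<Rightarrow> 'k \<Rightarrow> (nat \<Rightarrow> real) \<Rightarrow> nat \<Rightarrow> real"
where
  "received N a z k s n = s n + interf N a z k s n"

definition tone_objective ::
  "nat \<Rightarrow> (nat \<Rightarrow> real) \<Rightarrow> ('k \<Rightarrow> nat \<Rightarrow> nat \<Rightarrow> real) \<Rightarrow> ('k \<Rightarrow> nat \<Rightarrow> real) \<Rightarrow> 'k \<Rightarrow> (nat \<Rightarrow> real) \<Rightarrow> real"
where
  "tone_objective N w a z k s = - (\<Sum>m\<in>{1..N}. w m * ln (1 + s m / interf N a z k s m))"

text \<open>
  \<open>along n s F\<close> views \<open>F\<close> as a function of the \<open>n\<close>-th power, the others being fixed to those of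
  \<open>s\<close>.
\<close>

definition along :: "nat \<Rightarrow> (nat \<Rightarrow> real) \<Rightarrow> ((nat \<Rightarrow> real) \<Rightarrow> real) \<Rightarrow> real \<Rightarrow> real" where
  "along n s F = (\<lambda>x. F (s(n := x)))"

text \<open>
  The derivative is two-sided also at an endpoint of the power interval: the functions linearised
  below are given by formulas that are smooth on a neighbourhood of that interval, since the
  noise powers are positive.
\<close>

definition LIN :: "(real \<Rightarrow> real) \<Rightarrow> real \<Rightarrow> real \<Rightarrow> real" where
  "LIN g x0 = (\<lambda>x. g x0 + deriv g x0 * (x - x0))"

definition approximation :: "(real \<Rightarrow> real) \<Rightarrow> (real \<Rightarrow> real) \<Rightarrow> real \<Rightarrow> real \<Rightarrow> real" where
  "approximation f1 f2 x0 = (\<lambda>x. f1 x + LIN f2 x0 x)"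

definition f_CADSB ::
  "nat \<Rightarrow> (nat \<Rightarrow> real) \<Rightarrow> ('k \<Rightarrow> nat \<Rightarrow> nat \<Rightarrow> real) \<Rightarrow> ('k \<Rightarrow> nat \<Rightarrow> real) \<Rightarrow> 'k \<Rightarrow> nat
    \<Rightarrow> (nat \<Rightarrow> real) \<Rightarrow> real \<Rightarrow> real"
where
  "f_CADSB N w a z k n st =
    approximation
      (along n st (\<lambda>s. - (\<Sum>m\<in>{1..N}. w m * ln (received N a z k s m))))
      (along n st (\<lambda>s. \<Sum>m\<in>{1..N}. w m * ln (interf N a z k s m)))
      (st n)"

definition f_IASB1 ::
  "nat \<Rightarrow> (nat \<Rightarrow> real) \<Rightarrow> ('k \<Rightarrow> nat \<Rightarrow> nat \<Rightarrow> real) \<Rightarrow> ('k \<Rightarrow> nat \<Rightarrow> real) \<Rightarrow> 'k \<Rightarrow> nat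
    \<Rightarrow> (nat \<Rightarrow> real) \<Rightarrow> real \<Rightarrow> real"
where
  "f_IASB1 N w a z k n st =
    approximation
      (along n st (\<lambda>s. - w n * ln (1 + s n / interf N a z k s n)))
      (along n st (\<lambda>s. - (\<Sum>m\<in>{1..N} - {n}. w m * ln (1 + s m / interf N a z k s m))))
      (st n)"

definition tighter_on ::
  "real set \<Rightarrow> (real \<Rightarrow> real) \<Rightarrow> (real \<Rightarrow> real) \<Rightarrow> (real \<Rightarrow> real) \<Rightarrow> bool"
where
  "tighter_on X f A B \<longleftrightarrow> (\<forall>x\<in>X. f x \<le> A x \<and> A x \<le> B x)"

end

(*
  Only the interferences of the other users depend on the n-th power, and they do so affinely. For a
  single such user, with interference p and received power q \<ge> p at the approximation point, a change
  of the interference by u turns both comparisons into ln y \<le> y - 1: the first with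
  y = (p + u) q / (p (q + u)), the second with y = (q + u) / q. The user n itself contributes the
  same term to all three functions.
*)
theory Submission
  imports Defs
begin

lemma LIN_eqI:
  assumes "(g has_real_derivative D) (at x0)"
  shows "LIN g x0 x = g x0 + D * (x - x0)"
  using assms by (simp add: LIN_def DERIV_imp_deriv)

lemma ln_one_plus_divide:
  fixes s i :: real
  assumes "s \<ge> 0" "i > 0"
  shows "ln (1 + s / i) = ln (s + i) - ln i"
proof -
  have "1 + s / i = (s + i) / i" using assms by (simp add: field_simps)
  then show ?thesis using assms by (simp add: ln_div)
qed

text \<open>Since q \<ge> p, the left side is concave in u on u > -p, and the right side is its
  tangent at u = 0. The proof avoids second derivatives: after ln y \<le> y - 1 only an inequality
  between fractions is left.\<close>

lemma ln_ratio_diff_le: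
  fixes p q u :: real
  assumes "p > 0" "q \<ge> p" "p + u > 0"
  shows "ln (p + u) - ln (q + u) \<le> ln p - ln q + (u / p - u / q)"
proof -
  have q: "q > 0" "q + u > 0" using assms by auto
  have "ln (p + u) - ln (q + u) - (ln p - ln q) = ln ((p + u) * q / (p * (q + u)))"
    using assms q by (simp add: ln_div ln_mult)
  also have "\<dots> \<le> (p + u) * q / (p * (q + u)) - 1"
    using assms q by (intro ln_le_minus_one) simp
  also have "\<dots> = (q - p) / p * (u / (q + u))"
    using assms q by (simp add: divide_simps) (simp add: algebra_simps)
  \<comment> \<open>The sign of u is irrelevant: u / q - u / (q + u) = u^2 / (q (q + u)) is
    nonnegative, and so is the factor (q - p) / p.\<close>
  also have "\<dots> \<le> (q - p) / p * (u / q)"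
    using assms q by (intro mult_left_mono) (auto simp: field_simps)
  also have "\<dots> = u / p - u / q"
    using assms q by (simp add: field_simps)
  finally show ?thesis by simp
qed

text \<open>Concavity of \<open>ln\<close>. This is the whole gap between the two approximations:
  for each other user, IASB1 linearises the logarithm of the received power, while CADSB keeps it
  exact.\<close>

lemma ln_add_le_tangent:
  fixes q u :: real
  assumes "q > 0" "q + u > 0"
  shows "ln (q + u) \<le> ln q + u / q"
proof -
  have "ln (q + u) - ln q = ln ((q + u) / q)"
    using assms by (simp add: ln_div)
  also have "\<dots> \<le> (q + u) / q - 1"
    using assms by (intro ln_le_minus_one) simp
  also have "\<dots> = u / q"
    using assms by (simp add: field_simps)
  finally show ?thesis by simp
qed

lemma interf_fun_upd_self [simp]:
  "interf N a z k (s(n := x)) n = interf N a z k s n"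
  unfolding interf_def by (auto intro!: sum.cong)

lemma interf_fun_upd_other:
  assumes "n \<in> {1..N}" "m \<noteq> n"
  shows "interf N a z k (s(n := x)) m = interf N a z k s m + a k m n * (x - s n)"
proof -
  have n: "n \<in> {1..N} - {m}" using assms by simp
  have "(\<Sum>j\<in>{1..N} - {m} - {n}. a k m j * (s(n := x)) j) = (\<Sum>j\<in>{1..N} - {m} - {n}. a k m j * s j)"
    by (intro sum.cong) auto
  then show ?thesis
    unfolding interf_def sum.remove[OF finite_Diff[OF finite_atLeastAtMost] n]
    by (simp add: algebra_simps)
qed

lemma interf_pos:
  assumes "\<And>j. j \<in> {1..N} \<Longrightarrow> a k m j \<ge> 0" "\<And>j. j \<in> {1..N} \<Longrightarrow> s j \<ge> 0" "z k m > 0"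
  shows "interf N a z k s m > 0"
  unfolding interf_def using assms by (intro add_nonneg_pos sum_nonneg) auto

text \<open>Separates the contribution of user \<open>n\<close> from a sum over the other users, in
  the same shape as for IASB1, so that the comparison can be made summand by summand.\<close>

lemma f_CADSB_eq:
  assumes n: "n \<in> {1..N}" and pos: "\<forall>m\<in>{1..N}. interf N a z k st m > 0"
  defines "I \<equiv> interf N a z k st"
  shows "f_CADSB N w a z k n st x = w n * (ln (I n) - ln (x + I n)) +
    (\<Sum>m\<in>{1..N} - {n}. w m * (ln (I m) + a k m n * (x - st n) / I m
       - ln (st m + I m + a k m n * (x - st n))))"
proof -
  have other: "interf N a z k (st(n := y)) m = I m + a k m n * (y - st n)"
    if "m \<in> {1..N} - {n}" for m y
    using that n unfolding I_def by (simp add: interf_fun_upd_other)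
  have g: "along n st (\<lambda>s. \<Sum>m\<in>{1..N}. w m * ln (interf N a z k s m)) =
      (\<lambda>y. w n * ln (I n) + (\<Sum>m\<in>{1..N} - {n}. w m * ln (I m + a k m n * (y - st n))))"
    unfolding along_def sum.remove[OF finite_atLeastAtMost n] using other by (simp add: I_def)
  \<comment> \<open>At y = \<open>st n\<close> the interference is \<open>I m\<close>, which gives
    the slope \<open>a k m n / I m\<close>; the term of user \<open>n\<close> is constant in
    y.\<close>
  have "((\<lambda>y. w n * ln (I n) + (\<Sum>m\<in>{1..N} - {n}. w m * ln (I m + a k m n * (y - st n))))
      has_real_derivative (\<Sum>m\<in>{1..N} - {n}. w m * (a k m n / I m))) (at (st n))"
    using pos unfolding I_def by (auto intro!: derivative_eq_intros sum.cong)
  note lin = LIN_eqI[OF this, of x]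
  have "along n st (\<lambda>s. - (\<Sum>m\<in>{1..N}. w m * ln (received N a z k s m))) x = - (w n * ln (x + I n)) -
      (\<Sum>m\<in>{1..N} - {n}. w m * ln (st m + I m + a k m n * (x - st n)))"
    unfolding along_def sum.remove[OF finite_atLeastAtMost n]
    using other by (simp add: received_def I_def add.assoc)
  moreover have "(\<Sum>m\<in>{1..N} - {n}. w m * (a k m n / I m)) * (x - st n) =
      (\<Sum>m\<in>{1..N} - {n}. w m * (a k m n * (x - st n) / I m))"
    by (simp add: sum_distrib_right mult.assoc)
  ultimately show ?thesis
    unfolding f_CADSB_def approximation_def g lin
    by (simp add: distrib_left right_diff_distrib sum.distrib sum_subtractf)
qed

lemma f_IASB1_eq:
  assumes n: "n \<in> {1..N}" and pos: "\<forall>m\<in>{1..N}. interf N a z k st m > 0"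
    and st: "\<forall>m\<in>{1..N}. st m \<ge> 0" and x: "x \<ge> 0"
  defines "I \<equiv> interf N a z k st"
  shows "f_IASB1 N w a z k n st x = w n * (ln (I n) - ln (x + I n)) +
    (\<Sum>m\<in>{1..N} - {n}. w m * (ln (I m) - ln (st m + I m)
       + (a k m n * (x - st n) / I m - a k m n * (x - st n) / (st m + I m))))"
proof -
  have other: "interf N a z k (st(n := y)) m = I m + a k m n * (y - st n)"
    if "m \<in> {1..N} - {n}" for m y
    using that n unfolding I_def by (simp add: interf_fun_upd_other)
  have I: "I m > 0" if "m \<in> {1..N}" for m
    using pos that by (simp add: I_def)
  \<comment> \<open>The logarithm of the quotient is not split here: this is an equality for all
    real y, and for some y the interference formula may fail to be positive. The split is made
    later, only at y = \<open>st n\<close>.\<close>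
  have g: "along n st (\<lambda>s. - (\<Sum>m\<in>{1..N} - {n}. w m * ln (1 + s m / interf N a z k s m))) =
      (\<lambda>y. - (\<Sum>m\<in>{1..N} - {n}. w m * ln (1 + st m / (I m + a k m n * (y - st n)))))"
    unfolding along_def using other by (auto intro!: sum.cong)
  have "((\<lambda>y. - (\<Sum>m\<in>{1..N} - {n}. w m * ln (1 + st m / (I m + a k m n * (y - st n)))))
      has_real_derivative (\<Sum>m\<in>{1..N} - {n}. w m * (a k m n / I m - a k m n / (st m + I m))))
      (at (st n))"
    unfolding sum_negf [symmetric]
  proof (rule DERIV_sum)
    fix m assume m: "m \<in> {1..N} - {n}"
    then have *: "I m > 0" "st m \<ge> 0" using I st by auto
    then have **: "1 + st m / I m > 0" by (simp add: add_pos_nonneg)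
    \<comment> \<open>The right side is the form that the chain rule produces; the left side is the
      difference of the slopes of the two logarithms at \<open>st n\<close>.\<close>
    have eq: "a k m n / I m - a k m n / (st m + I m) =
        st m * a k m n / (I m * I m) / (1 + st m / I m)"
      using * by (simp add: divide_simps add_pos_nonneg) (simp add: algebra_simps)
    show "((\<lambda>y. - (w m * ln (1 + st m / (I m + a k m n * (y - st n))))) has_real_derivative
        w m * (a k m n / I m - a k m n / (st m + I m))) (at (st n))"
      unfolding eq using * ** by (auto intro!: derivative_eq_intros simp: mult.commute)
  qed
  note lin = LIN_eqI[OF this, of x]
  have "(\<Sum>m\<in>{1..N} - {n}. w m * ln (1 + st m / I m)) =
      (\<Sum>m\<in>{1..N} - {n}. w m * (ln (st m + I m) - ln (I m)))"
    using I st by (intro sum.cong) (auto simp: ln_one_plus_divide)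
  moreover have "ln (1 + x / I n) = ln (x + I n) - ln (I n)"
    using I[OF n] x by (rule ln_one_plus_divide[rotated])
  moreover have "(\<Sum>m\<in>{1..N} - {n}. w m * (a k m n / I m - a k m n / (st m + I m))) * (x - st n) =
      (\<Sum>m\<in>{1..N} - {n}. w m * (a k m n * (x - st n) / I m - a k m n * (x - st n) / (st m + I m)))"
    by (simp add: sum_distrib_right mult.assoc left_diff_distrib)
  ultimately show ?thesis
    unfolding f_IASB1_def approximation_def g lin
    by (simp add: along_def I_def distrib_left right_diff_distrib sum.distrib sum_subtractf)
qed

theorem mainTheorem2:
  fixes N :: nat
    and tones :: "'k set"
    and w :: "nat \<Rightarrow> real"
    and a :: "'k \<Rightarrow> nat \<Rightarrow> nat \<Rightarrow> real"
    and z smask :: "'k \<Rightarrow> nat \<Rightarrow> real"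
    and k :: 'k
    and n :: nat
    and st :: "nat \<Rightarrow> real"
  assumes weights: "\<forall>i\<in>{1..N}. w i \<ge> 0"
    and gains: "\<forall>t\<in>tones. \<forall>i\<in>{1..N}. \<forall>j\<in>{1..N}. a t i j \<ge> 0"
    and noise: "\<forall>t\<in>tones. \<forall>i\<in>{1..N}. z t i > 0"
    and masks: "\<forall>t\<in>tones. \<forall>i\<in>{1..N}. smask t i > 0"
    and tone: "k \<in> tones"
    and user: "n \<in> {1..N}"
    and point: "st \<in> power_box N smask k"
  shows "tighter_on (power_interval smask k n)
           (along n st (tone_objective N w a z k))
           (f_IASB1 N w a z k n st)
           (f_CADSB N w a z k n st)"
proof -
  let ?I = "interf N a z k st" and ?M = "{1..N} - {n}"
  have st: "\<forall>m\<in>{1..N}. st m \<ge> 0"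
    using point by (auto simp: power_box_def power_interval_def PiE_def Pi_def)
  \<comment> \<open>Stated for a general power vector, as it is needed both at the approximation
    point and after the change of the power of user \<open>n\<close>.\<close>
  have pos: "interf N a z k s m > 0" if "m \<in> {1..N}" "\<And>j. j \<in> {1..N} \<Longrightarrow> s j \<ge> 0" for s m
    using that gains noise tone by (intro interf_pos) auto
  have I: "\<forall>m\<in>{1..N}. ?I m > 0"
    using pos st by blast
  show ?thesis
    unfolding tighter_on_def
  proof (intro ballI)
    fix x assume "x \<in> power_interval smask k n"
    then have x: "x \<ge> 0" by (simp add: power_interval_def)
    let ?u = "\<lambda>m. a k m n * (x - st n)"
    have upd: "interf N a z k (st(n := x)) m = ?I m + ?u m" if "m \<in> ?M" for m
      using that user by (simp add: interf_fun_upd_other)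
    \<comment> \<open>The increment \<open>?u m\<close> is negative if \<open>x < st n\<close> and
      the gain is positive. The sum is still positive, being the interference of the nonnegative
      power vector \<open>st(n := x)\<close>.\<close>
    have u: "?I m + ?u m > 0" if "m \<in> ?M" for m
      using pos[of m "st(n := x)"] that st x upd by auto
    have "(\<Sum>m\<in>?M. w m * ln (1 + st m / interf N a z k (st(n := x)) m)) =
        (\<Sum>m\<in>?M. w m * (ln (st m + ?I m + ?u m) - ln (?I m + ?u m)))"
      using st u by (intro sum.cong) (simp_all add: upd ln_one_plus_divide add.assoc)
    \<comment> \<open>Brings the objective to the shape of the two closed forms, with the same first
      summand for user \<open>n\<close>, which then cancels in both comparisons.\<close>
    then have f: "along n st (tone_objective N w a z k) x = w n * (ln (?I n) - ln (x + ?I n)) +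
        (\<Sum>m\<in>?M. w m * (ln (?I m + ?u m) - ln (st m + ?I m + ?u m)))"
      using I user x
      unfolding along_def tone_objective_def sum.remove[OF finite_atLeastAtMost user]
      by (simp add: ln_one_plus_divide sum_subtractf algebra_simps)
    have "along n st (tone_objective N w a z k) x \<le> f_IASB1 N w a z k n st x"
      unfolding f f_IASB1_eq[OF user I st x]
    proof (intro add_left_mono sum_mono mult_left_mono)
      fix m assume m: "m \<in> ?M"
      then show "w m \<ge> 0" using weights by simp
      \<comment> \<open>Here p is the interference \<open>?I m\<close> and q the received power
        \<open>st m + ?I m\<close>; q \<ge> p because \<open>st m\<close> is nonnegative.\<close>
      show "ln (?I m + ?u m) - ln (st m + ?I m + ?u m) \<le>
          ln (?I m) - ln (st m + ?I m) + (?u m / ?I m - ?u m / (st m + ?I m))"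
        using m I u st by (intro ln_ratio_diff_le) auto
    qed
    moreover have "f_IASB1 N w a z k n st x \<le> f_CADSB N w a z k n st x"
      unfolding f_CADSB_eq[OF user I] f_IASB1_eq[OF user I st x]
    proof (intro add_left_mono sum_mono mult_left_mono)
      fix m assume m: "m \<in> ?M"
      then show "w m \<ge> 0" using weights by simp
      have "st m \<ge> 0" "?I m > 0" using m I st by auto
      then have "ln (st m + ?I m + ?u m) \<le> ln (st m + ?I m) + ?u m / (st m + ?I m)"
        using u[OF m] by (intro ln_add_le_tangent) auto
      \<comment> \<open>The terms \<open>ln (?I m) + ?u m / ?I m\<close> are common to both sides,
        which leaves the negated tangent inequality.\<close>
      then show "ln (?I m) - ln (st m + ?I m) + (?u m / ?I m - ?u m / (st m + ?I m)) \<le>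
          ln (?I m) + ?u m / ?I m - ln (st m + ?I m + ?u m)"
        by simp
    qed
    ultimately show "along n st (tone_objective N w a z k) x \<le> f_IASB1 N w a z k n st x \<and>
        f_IASB1 N w a z k n st x \<le> f_CADSB N w a z k n st x" ..
  qed
qed

end
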